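(* The complete feather $F$ is a connected homogeneous non-Hausdorff $1$-manifold.
   Context: The complete feather $F$ is the following topological space. Its underlying set is the set of all finite sequences $s=(s_0,\dots,s_n)$, for some $n\ge 0$, with $s_i\in\mathbb{R}$ and $s_0<s_1<\dots<s_{n-1}\le s_n$ (the last inequality is not strict, all the others are; for $n=0$ there is no condition on $s_0$). It carries the partial order defined by $(s_0,\dots,s_n)<(t_0,\dots,t_m)$ if and only if $n\le m$, $s_i=t_i$ for $i=0,\dots,n-1$, and $s_n<t_n$. $F$ is given the order topology of this partial order, i.e. the topology having as a base the open intervals $\{x\in F: a<x<b\}$ with $a,b\in F$, $a<b$. A $1$-manifold is a topological space in which every point has an open neighborhood homeomorphic to $\mathbb{R}$ (neither the Hausdorff axiom nor second countability is assumed). A topological space $X$ is homogeneous if for all $x,y\in X$ there is a homeomorphism $h:X\to X$ with $h(x)=y$. *)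

theory Defs
  imports "HOL-Analysis.Analysis"
begin

text \<open>The sequence \<open>(s\<^sub>0, \<dots>, s\<^sub>n)\<close> is a list of length \<open>n + 1\<close>.  All the
  inequalities between consecutive entries are strict, except possibly the last one.\<close>

definition feather_carrier :: "real list set" where
  "feather_carrier =
     {s. \<exists>n. length s = Suc n \<and> (\<forall>i. Suc i < n \<longrightarrow> s ! i < s ! Suc i) \<and>
             (1 \<le> n \<longrightarrow> s ! (n - 1) \<le> s ! n)}"

definition feather_less :: "real list \<Rightarrow> real list \<Rightarrow> bool" where
  "feather_less s t \<longleftrightarrow>
     (let n = length s - 1; m = length t - 1
      in n \<le> m \<and> (\<forall>i<n. s ! i = t ! i) \<and> s ! n < t ! n)"

definition feather_interval :: "real list \<Rightarrow> real list \<Rightarrow> real list set" where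
  "feather_interval a b = {x \<in> feather_carrier. feather_less a x \<and> feather_less x b}"

definition feather_base :: "real list set \<Rightarrow> bool" where
  "feather_base U \<longleftrightarrow>
     (\<exists>a\<in>feather_carrier. \<exists>b\<in>feather_carrier. feather_less a b \<and> U = feather_interval a b)"

text \<open>The function \<open>topology\<close> is only meaningful on families of sets that satisfy the axioms of
  a topology; that unions of intervals do so is proved below (\<open>openin_feather\<close>).\<close>

definition feather :: "real list topology" where
  "feather = topology (arbitrary union_of feather_base)"

definition one_manifold :: "'a topology \<Rightarrow> bool" where
  "one_manifold X \<longleftrightarrow>
     (\<forall>x\<in>topspace X. \<exists>U. openin X U \<and> x \<in> U \<and>
        subtopology X U homeomorphic_space (euclidean :: real topology))"

definition homogeneous_space :: "'a topology \<Rightarrow> bool" where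
  "homogeneous_space X \<longleftrightarrow>
     (\<forall>x\<in>topspace X. \<forall>y\<in>topspace X. \<exists>h. homeomorphic_map X X h \<and> h x = y)"

lemma feather_less_irrefl: "\<not> feather_less s s"
  by (simp add: feather_less_def)

lemma feather_less_trans:
  assumes "feather_less r s" "feather_less s t"
  shows "feather_less r t"
proof -
  have "r ! (length r - 1) < t ! (length r - 1)"
    using assms unfolding feather_less_def Let_def
    by (metis le_neq_implies_less less_trans)
  moreover have "\<forall>i<length r - 1. r ! i = t ! i"
    using assms unfolding feather_less_def Let_def by auto
  ultimately show ?thesis
    using assms unfolding feather_less_def Let_def by auto
qed

lemma feather_predecessors_le:
  assumes "a \<in> feather_carrier" "b \<in> feather_carrier"
    and "feather_less a x" "feather_less b x" and le: "length a \<le> length b"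
  shows "a = b \<or> feather_less a b \<or> feather_less b a"
proof (cases "length a = length b")
  case True
  have nz: "length a > 0" using assms(1) by (auto simp: feather_carrier_def)
  have pre: "\<forall>i<length a - 1. a ! i = b ! i"
    using assms(3,4) True unfolding feather_less_def Let_def by auto
  consider "a ! (length a - 1) = b ! (length a - 1)" | "a ! (length a - 1) < b ! (length a - 1)"
    | "b ! (length a - 1) < a ! (length a - 1)" by linarith
  then show ?thesis
  proof cases
    case 1
    have "a = b"
    proof (rule nth_equalityI)
      fix i assume "i < length a"
      then show "a ! i = b ! i" using pre 1 by (cases "i = length a - 1") auto
    qed (use True in simp)
    then show ?thesis by simp
  next
    case 2 then show ?thesis using pre True unfolding feather_less_def Let_def by simp
  next
    case 3 then show ?thesis using pre True unfolding feather_less_def Let_def by simp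
  qed
next
  case False
  have "length a - 1 < length b - 1"
    using False le assms(1,2) by (auto simp: feather_carrier_def)
  then have "feather_less a b"
    using assms(3,4) unfolding feather_less_def Let_def by auto
  then show ?thesis by simp
qed

lemma feather_predecessors:
  assumes "a \<in> feather_carrier" "b \<in> feather_carrier" "feather_less a x" "feather_less b x"
  obtains c where "c \<in> feather_carrier" "feather_less c x"
    "c = a \<or> feather_less a c" "c = b \<or> feather_less b c"
proof -
  have "a = b \<or> feather_less a b \<or> feather_less b a"
  proof (cases "length a \<le> length b")
    case True
    then show ?thesis using feather_predecessors_le[of a b x] assms by blast
  next
    case False
    then have "length b \<le> length a" by simp
    then show ?thesis using feather_predecessors_le[of b a x] assms by blast
  qed
  then show ?thesis using that[of a] that[of b] assms by blast
qed

lemma feather_successors: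
  assumes x: "x \<in> feather_carrier" and a: "feather_less x a" and b: "feather_less x b"
  obtains c where "c \<in> feather_carrier" "feather_less x c" "feather_less c a" "feather_less c b"
proof -
  obtain n where n: "length x = Suc n" "\<forall>i. Suc i < n \<longrightarrow> x ! i < x ! Suc i"
    "1 \<le> n \<longrightarrow> x ! (n - 1) \<le> x ! n"
    using x by (auto simp: feather_carrier_def)
  have "x ! n < min (a ! n) (b ! n)"
    using a b n(1) by (simp add: feather_less_def)
  then obtain d where d: "x ! n < d" "d < a ! n" "d < b ! n"
    using dense by (metis min_less_iff_conj)
  let ?c = "x[n := d]"
  have "?c \<in> feather_carrier"
    unfolding feather_carrier_def using n d(1)
    by (auto intro!: exI[of _ n] simp: nth_list_update)
  moreover have "feather_less x ?c" "feather_less ?c a" "feather_less ?c b"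
    using n(1) d a b by (auto simp: feather_less_def)
  ultimately show ?thesis using that by blast
qed

lemma istopology_feather: "istopology (arbitrary union_of feather_base)"
  unfolding istopology_base_eq
proof (intro allI impI, elim conjE)
  fix S T assume S: "feather_base S" and T: "feather_base T"
  obtain a b where ab: "a \<in> feather_carrier" "b \<in> feather_carrier" "S = feather_interval a b"
    using S by (auto simp: feather_base_def)
  obtain a' b' where ab': "a' \<in> feather_carrier" "b' \<in> feather_carrier" "T = feather_interval a' b'"
    using T by (auto simp: feather_base_def)
  show "(arbitrary union_of feather_base) (S \<inter> T)"
    unfolding arbitrary_union_of_alt
  proof
    fix x assume "x \<in> S \<inter> T"
    then have x: "x \<in> feather_carrier" "feather_less a x" "feather_less x b"
      "feather_less a' x" "feather_less x b'"
      using ab ab' by (auto simp: feather_interval_def)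
    obtain c where c: "c \<in> feather_carrier" "feather_less c x"
      "c = a \<or> feather_less a c" "c = a' \<or> feather_less a' c"
      using feather_predecessors ab ab' x by metis
    obtain d where d: "d \<in> feather_carrier" "feather_less x d" "feather_less d b" "feather_less d b'"
      using feather_successors x by metis
    have "feather_base (feather_interval c d)"
      using c d feather_less_trans unfolding feather_base_def by blast
    moreover have "x \<in> feather_interval c d"
      using x c d by (simp add: feather_interval_def)
    moreover have "feather_interval c d \<subseteq> S \<inter> T"
      using c d ab ab' feather_less_trans unfolding feather_interval_def by blast
    ultimately show "\<exists>U. feather_base U \<and> x \<in> U \<and> U \<subseteq> S \<inter> T" by blast
  qed
qed

lemma openin_feather: "openin feather = arbitrary union_of feather_base"
  unfolding feather_def by (rule topology_inverse'[OF istopology_feather])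

lemma feather_has_predecessor:
  assumes "x \<in> feather_carrier"
  obtains a where "a \<in> feather_carrier" "feather_less a x"
proof
  show "[x ! 0 - 1] \<in> feather_carrier" by (simp add: feather_carrier_def)
  show "feather_less [x ! 0 - 1] x" by (simp add: feather_less_def)
qed

lemma feather_has_successor:
  assumes "x \<in> feather_carrier"
  obtains b where "b \<in> feather_carrier" "feather_less x b"
proof -
  obtain n where n: "length x = Suc n" "\<forall>i. Suc i < n \<longrightarrow> x ! i < x ! Suc i"
    "1 \<le> n \<longrightarrow> x ! (n - 1) \<le> x ! n"
    using assms by (auto simp: feather_carrier_def)
  have "x[n := x ! n + 1] \<in> feather_carrier"
    unfolding feather_carrier_def using n
    by (auto intro!: exI[of _ n] simp: nth_list_update)
  moreover have "feather_less x (x[n := x ! n + 1])"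
    using n(1) by (auto simp: feather_less_def)
  ultimately show ?thesis using that by blast
qed

lemma topspace_feather: "topspace feather = feather_carrier"
proof
  show "topspace feather \<subseteq> feather_carrier"
    using openin_topspace[of feather]
    by (force simp: openin_feather arbitrary_union_of_alt feather_base_def feather_interval_def)
  have "(arbitrary union_of feather_base) feather_carrier"
    unfolding arbitrary_union_of_alt
  proof
    fix x assume x: "x \<in> feather_carrier"
    obtain a where a: "a \<in> feather_carrier" "feather_less a x"
      using feather_has_predecessor[OF x] by blast
    obtain b where b: "b \<in> feather_carrier" "feather_less x b"
      using feather_has_successor[OF x] by blast
    have "feather_base (feather_interval a b)"
      using a b feather_less_trans unfolding feather_base_def by blast
    moreover have "x \<in> feather_interval a b" "feather_interval a b \<subseteq> feather_carrier"
      using x a b by (auto simp: feather_interval_def)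
    ultimately show "\<exists>U. feather_base U \<and> x \<in> U \<and> U \<subseteq> feather_carrier" by blast
  qed
  then show "feather_carrier \<subseteq> topspace feather"
    by (intro openin_subset) (simp add: openin_feather)
qed

end

theory Submission
  imports Defs
begin

text \<open>A sequence \<open>(s\<^sub>0, \<dots>, s\<^sub>n)\<close> is the same thing as a pair \<open>(A, r)\<close> of a finite set
  \<open>A = {s\<^sub>0, \<dots>, s\<^bsub>n-1\<^esub>} \<subseteq> (-\<infinity>, r]\<close> and a real \<open>r = s\<^sub>n\<close>; in these terms \<open>(A, r) < (B, t)\<close> iff
  \<open>r < t\<close> and \<open>A = B \<inter> (-\<infinity>, r]\<close>.  Hence \<open>r\<close> is an open continuous function on the feather which
  maps the predecessors of \<open>(B, t)\<close> bijectively onto \<open>(-\<infinity>, t)\<close>, and any two such sets of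
  predecessors meet: the feather is a connected 1-manifold.  For every finite set \<open>C\<close> the map
  \<open>(A, r) \<mapsto> (A \<triangle> (C \<inter> (-\<infinity>, r]), r)\<close> is an involutive order automorphism; taking \<open>C = A\<close> and
  composing with a translation moves any point \<open>(A, r)\<close> to \<open>(\<emptyset>, 0)\<close>.  Finally \<open>(0)\<close> and \<open>(0, 0)\<close>
  have the same predecessors, so they cannot be separated.\<close>

section \<open>Sequences as pairs of a finite set and a real number\<close>

definition feather_point :: "real set \<Rightarrow> real \<Rightarrow> real list" where
  "feather_point A r = sorted_list_of_set A @ [r]"

lemma last_feather_point [simp]: "last (feather_point A r) = r"
  by (simp add: feather_point_def)

lemma set_butlast_feather_point [simp]:
  "finite A \<Longrightarrow> set (butlast (feather_point A r)) = A"
  by (simp add: feather_point_def)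

text \<open>The definition compares only neighbouring entries; the final entry of an increasing
  front is its largest, so bounding that one bounds the whole front. This gets rid of
  indices.\<close>

lemma feather_carrier_iff:
  "s \<in> feather_carrier \<longleftrightarrow>
     s \<noteq> [] \<and> sorted_wrt (<) (butlast s) \<and> (\<forall>x\<in>set (butlast s). x \<le> last s)"
proof (cases s rule: rev_cases)
  case Nil
  then show ?thesis by (simp add: feather_carrier_def)
next
  case (snoc xs r)
  have "s \<in> feather_carrier \<longleftrightarrow> (\<forall>i. Suc i < length xs \<longrightarrow> xs ! i < xs ! Suc i) \<and>
          (1 \<le> length xs \<longrightarrow> xs ! (length xs - 1) \<le> r)"
    by (auto simp: feather_carrier_def snoc nth_append)
  also have "\<dots> \<longleftrightarrow> sorted_wrt (<) xs \<and> (\<forall>x\<in>set xs. x \<le> r)"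
  proof (cases xs rule: rev_cases)
    case (snoc ys y)
    have "(\<forall>x\<in>set xs. x \<le> r) \<longleftrightarrow> y \<le> r" if "sorted_wrt (<) xs"
      using that by (auto simp: snoc sorted_wrt_append)
    moreover have "sorted_wrt (<) xs \<longleftrightarrow> (\<forall>i. Suc i < length xs \<longrightarrow> xs ! i < xs ! Suc i)"
      by (rule sorted_wrt_iff_nth_Suc_transp) simp
    moreover have "(1 \<le> length xs \<longrightarrow> xs ! (length xs - 1) \<le> r) \<longleftrightarrow> y \<le> r"
      by (simp add: snoc)
    ultimately show ?thesis by blast
  qed simp
  finally show ?thesis by (simp add: snoc)
qed

lemma feather_point_in_carrier [simp]:
  "finite A \<Longrightarrow> feather_point A r \<in> feather_carrier \<longleftrightarrow> A \<subseteq> {..r}"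
  by (auto simp: feather_carrier_iff feather_point_def)

lemma feather_point_eq:
  assumes "s \<in> feather_carrier"
  shows "feather_point (set (butlast s)) (last s) = s"
  using assms
  by (simp add: feather_carrier_iff feather_point_def strict_sorted_iff
      sorted_list_of_set.idem_if_sorted_distinct)

lemma feather_carrier_cases:
  assumes "s \<in> feather_carrier"
  obtains A r where "finite A" "A \<subseteq> {..r}" "s = feather_point A r"
  using feather_point_eq[OF assms] assms
  by (metis List.finite_set feather_point_in_carrier)

section \<open>The order in terms of pairs\<close>

lemma feather_less_iff_prefix:
  "feather_less (xs @ [r]) (ys @ [t]) \<longleftrightarrow>
     (\<exists>zs. ys = xs @ zs \<and> r < hd (zs @ [t]))"
proof
  assume "feather_less (xs @ [r]) (ys @ [t])"
  then have le: "length xs \<le> length ys" and eq: "\<forall>i<length xs. xs ! i = ys ! i"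
    and less: "r < (ys @ [t]) ! length xs"
    by (auto simp: feather_less_def Let_def nth_append split: if_splits)
  have "take (length xs) ys = xs"
    using le eq by (intro nth_equalityI) auto
  then obtain zs where zs: "ys = xs @ zs"
    by (metis append_take_drop_id)
  \<comment> \<open>\<open>hd (zs @ [t])\<close> is the entry of \<open>ys @ [t]\<close> at index
    \<open>length xs\<close>: the first surplus entry, or \<open>t\<close> if \<open>zs\<close> is
    empty.\<close>
  with less show "\<exists>zs. ys = xs @ zs \<and> r < hd (zs @ [t])"
    by (auto simp: hd_conv_nth nth_append split: if_splits)
next
  assume "\<exists>zs. ys = xs @ zs \<and> r < hd (zs @ [t])"
  then show "feather_less (xs @ [r]) (ys @ [t])"
    by (auto simp: feather_less_def nth_append hd_conv_nth split: if_splits)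
qed

text \<open>Both sides are sorted and distinct with the same entries, which determines the list. It
  supplies the prefix for the converse direction of \<open>feather_less_point_iff\<close>.\<close>

lemma sorted_list_of_set_Int_atMost:
  fixes B :: "'a::linorder set"
  assumes "finite B"
  shows "sorted_list_of_set B =
    sorted_list_of_set (B \<inter> {..r}) @ sorted_list_of_set (B \<inter> {r<..})"
proof -
  let ?l = "sorted_list_of_set (B \<inter> {..r}) @ sorted_list_of_set (B \<inter> {r<..})"
  have "set ?l = B" using assms by auto
  moreover have "sorted ?l" "distinct ?l"
    using assms by (fastforce simp: sorted_append)+
  ultimately show ?thesis
    by (metis sorted_list_of_set.idem_if_sorted_distinct list.map_ident subset_UNIV)
qed

lemma feather_less_point_iff:
  assumes "finite A" "A \<subseteq> {..r}" "finite B" "B \<subseteq> {..t}"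
  shows "feather_less (feather_point A r) (feather_point B t) \<longleftrightarrow> r < t \<and> A = B \<inter> {..r}"
proof
  assume "feather_less (feather_point A r) (feather_point B t)"
  then obtain zs where zs: "sorted_list_of_set B = sorted_list_of_set A @ zs" "r < hd (zs @ [t])"
    by (auto simp: feather_point_def feather_less_iff_prefix)
  have B: "B = A \<union> set zs"
    using arg_cong[OF zs(1), of set] assms by simp
  have "sorted zs"
    using zs(1) by (metis sorted_append sorted_sorted_list_of_set)
  \<comment> \<open>As \<open>zs\<close> is sorted, the bound on its head passes to all its entries;
    cutting \<open>B\<close> at \<open>r\<close> therefore removes exactly \<open>zs\<close> and
    leaves \<open>A\<close>.\<close>
  then have gt: "\<forall>z\<in>set zs. r < z"
    using zs(2) by (cases zs) auto
  \<comment> \<open>For empty \<open>zs\<close> this is the comparison itself; otherwise an entry of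
    \<open>zs\<close> lies above \<open>r\<close> and, being in \<open>B\<close>, is at most
    \<open>t\<close>.\<close>
  have "r < t"
    using zs(2) gt B assms(4) by (cases zs) auto
  with gt B assms show "r < t \<and> A = B \<inter> {..r}" by auto
next
  assume *: "r < t \<and> A = B \<inter> {..r}"
  let ?zs = "sorted_list_of_set (B \<inter> {r<..})"
  have "r < hd (?zs @ [t])"
  proof (cases "?zs = []")
    case False
    then have "hd ?zs \<in> set ?zs" by (rule hd_in_set)
    with False assms show ?thesis by simp
  qed (use * in simp)
  then show "feather_less (feather_point A r) (feather_point B t)"
    using * sorted_list_of_set_Int_atMost[OF assms(3), of r]
    unfolding feather_point_def feather_less_iff_prefix by auto
qed

lemma feather_less_iff:
  assumes "s \<in> feather_carrier" "t \<in> feather_carrier"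
  shows "feather_less s t \<longleftrightarrow>
    last s < last t \<and> set (butlast s) = set (butlast t) \<inter> {..last s}"
  using assms by (auto simp: feather_less_point_iff elim!: feather_carrier_cases)

lemma feather_eqI:
  assumes "s \<in> feather_carrier" "t \<in> feather_carrier"
    and "set (butlast s) = set (butlast t)" "last s = last t"
  shows "s = t"
  using assms feather_point_eq by metis

section \<open>Open sets and initial segments\<close>

lemma openin_feather_iff:
  "openin feather U \<longleftrightarrow>
     (\<forall>x\<in>U. \<exists>a\<in>feather_carrier. \<exists>b\<in>feather_carrier.
        x \<in> feather_interval a b \<and> feather_interval a b \<subseteq> U)"
proof -
  \<comment> \<open>Transitivity through a point of the interval yields the comparison of end points
    that \<open>feather_base\<close> asks for.\<close>
  have "feather_less a b" if "x \<in> feather_interval a b" for a b x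
    using that feather_less_trans by (auto simp: feather_interval_def)
  then show ?thesis
    unfolding openin_feather arbitrary_union_of_alt feather_base_def by blast
qed

text \<open>These initial segments are the chart domains, with \<open>last\<close> as
  coordinate.\<close>

definition feather_below :: "real list \<Rightarrow> real list set" where
  "feather_below b = {x \<in> feather_carrier. feather_less x b}"

lemma openin_feather_below:
  assumes "b \<in> feather_carrier"
  shows "openin feather (feather_below b)"
  unfolding openin_feather_iff
proof
  fix x assume x: "x \<in> feather_below b"
  then obtain a where "a \<in> feather_carrier" "feather_less a x"
    by (auto simp: feather_below_def elim: feather_has_predecessor)
  with x assms show "\<exists>a\<in>feather_carrier. \<exists>b'\<in>feather_carrier.
      x \<in> feather_interval a b' \<and> feather_interval a b' \<subseteq> feather_below b"
    by (auto simp: feather_below_def feather_interval_def)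
qed

text \<open>The front of a predecessor of \<open>b\<close> is the front of \<open>b\<close> cut at
  the predecessor's final entry, so the final entry determines everything.\<close>

lemma inj_on_last_feather_below:
  assumes "b \<in> feather_carrier"
  shows "inj_on last (feather_below b)"
  using assms by (auto simp: inj_on_def feather_below_def feather_less_iff intro: feather_eqI)

text \<open>For \<open>r < last b\<close> this is the unique predecessor of \<open>b\<close> with
  final entry \<open>r\<close>, so it inverts \<open>last\<close> on
  \<open>feather_below b\<close>.\<close>

definition feather_cut :: "real list \<Rightarrow> real \<Rightarrow> real list" where
  "feather_cut b r = feather_point (set (butlast b) \<inter> {..r}) r"

lemma feather_cut_in_carrier [simp]: "feather_cut b r \<in> feather_carrier"
  by (simp add: feather_cut_def)

lemma last_feather_cut [simp]: "last (feather_cut b r) = r"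
  by (simp add: feather_cut_def)

lemma set_butlast_feather_cut [simp]:
  "set (butlast (feather_cut b r)) = set (butlast b) \<inter> {..r}"
  by (simp add: feather_cut_def)

lemma feather_cut_less:
  "b \<in> feather_carrier \<Longrightarrow> r < last b \<Longrightarrow> feather_less (feather_cut b r) b"
  by (simp add: feather_less_iff)

lemma less_feather_cut:
  "a \<in> feather_carrier \<Longrightarrow> b \<in> feather_carrier \<Longrightarrow> feather_less a b \<Longrightarrow> last a < r \<Longrightarrow>
    feather_less a (feather_cut b r)"
  by (auto simp: feather_less_iff)

text \<open>Raising only the final entry works because the front stays within
  \<open>{..last x}\<close>. Unlike in \<open>feather_has_successor\<close>, the new final entry is
  prescribed.\<close>

lemma feather_extend:
  assumes "x \<in> feather_carrier" "last x < r"
  obtains c where "c \<in> feather_carrier" "feather_less x c" "last c = r"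
proof
  let ?c = "feather_point (set (butlast x)) r"
  have le: "set (butlast x) \<subseteq> {..last x}"
    using assms(1) by (auto simp: feather_carrier_iff)
  then show c: "?c \<in> feather_carrier" using assms(2) by auto
  show "feather_less x ?c" "last ?c = r" using assms c le by (auto simp: feather_less_iff)
qed

lemma last_image_feather_below:
  assumes "b \<in> feather_carrier"
  shows "last ` feather_below b = {..<last b}"
proof
  show "last ` feather_below b \<subseteq> {..<last b}"
    using assms by (auto simp: feather_below_def feather_less_iff)
  show "{..<last b} \<subseteq> last ` feather_below b"
  proof
    fix r assume "r \<in> {..<last b}"
    then have "feather_cut b r \<in> feather_below b"
      using assms by (simp add: feather_below_def feather_cut_less)
    then show "r \<in> last ` feather_below b" by (metis imageI last_feather_cut)
  qed
qed

lemma last_image_feather_interval: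
  assumes "a \<in> feather_carrier" "b \<in> feather_carrier" "feather_less a b"
  shows "last ` feather_interval a b = {last a<..<last b}"
proof
  show "last ` feather_interval a b \<subseteq> {last a<..<last b}"
    using assms by (auto simp: feather_interval_def feather_less_iff)
  show "{last a<..<last b} \<subseteq> last ` feather_interval a b"
  proof
    fix r assume "r \<in> {last a<..<last b}"
    then have "feather_cut b r \<in> feather_interval a b"
      using assms by (simp add: feather_interval_def feather_cut_less less_feather_cut)
    then show "r \<in> last ` feather_interval a b" by (metis imageI last_feather_cut)
  qed
qed

section \<open>The coordinate \<open>last\<close> and the charts\<close>

lemma continuous_map_last_feather: "continuous_map feather euclideanreal last"
  unfolding continuous_map_def
proof (intro conjI allI impI)
  fix V :: "real set" assume "openin euclideanreal V"
  then have V: "open V" by simp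
  show "openin feather {x \<in> topspace feather. last x \<in> V}"
    unfolding openin_feather_iff topspace_feather
  proof
    fix x assume "x \<in> {x \<in> feather_carrier. last x \<in> V}"
    then have x: "x \<in> feather_carrier" "last x \<in> V" by auto
    then obtain e where e: "e > 0" "ball (last x) e \<subseteq> V"
      using V openE by blast
    \<comment> \<open>Extending \<open>x\<close> up to \<open>last x + e\<close> and cutting it at
      \<open>last x - e\<close> gives an interval whose image under \<open>last\<close> is exactly
      the ball.\<close>
    obtain b where b: "b \<in> feather_carrier" "feather_less x b" "last b = last x + e"
      using feather_extend[of x "last x + e"] x e by auto
    define a where "a = feather_cut x (last x - e)"
    have a: "a \<in> feather_carrier" "feather_less a x" "last a = last x - e"
      using x e by (auto simp: a_def feather_cut_less)
    have "last ` feather_interval a b = {last x - e<..<last x + e}"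
      using last_image_feather_interval[of a b] a b feather_less_trans by metis
    also have "\<dots> = ball (last x) e" by (simp add: ball_eq_greaterThanLessThan)
    finally have "last ` feather_interval a b \<subseteq> V" using e by simp
    then show "\<exists>a\<in>feather_carrier. \<exists>b\<in>feather_carrier. x \<in> feather_interval a b \<and>
        feather_interval a b \<subseteq> {x \<in> feather_carrier. last x \<in> V}"
      using a b x by (intro bexI[of _ a] bexI[of _ b]) (auto simp: feather_interval_def)
  qed
qed auto

lemma open_map_last_feather: "open_map feather euclideanreal last"
  unfolding open_map_def
proof (intro allI impI)
  fix U assume U: "openin feather U"
  have "\<exists>T. open T \<and> v \<in> T \<and> T \<subseteq> last ` U" if "v \<in> last ` U" for v
  proof -
    obtain x where x: "x \<in> U" "v = last x" using \<open>v \<in> last ` U\<close> by blast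
    then obtain a b where ab: "a \<in> feather_carrier" "b \<in> feather_carrier"
      "x \<in> feather_interval a b" "feather_interval a b \<subseteq> U"
      using U unfolding openin_feather_iff by meson
    then have "feather_less a b"
      by (auto simp: feather_interval_def intro: feather_less_trans)
    then have "last ` feather_interval a b = {last a<..<last b}"
      using last_image_feather_interval ab by blast
    then show ?thesis
      using ab x by (metis image_eqI image_mono open_greaterThanLessThan)
  qed
  then have "open (last ` U)" by (subst open_subopen) blast
  then show "openin euclideanreal (last ` U)" by simp
qed

text \<open>The chart is the negative logarithm of the distance to \<open>c\<close>.\<close>

lemma lessThan_homeomorphic_space_real:
  fixes c :: real
  shows "subtopology euclideanreal {..<c} homeomorphic_space euclideanreal"
proof -
  have "homeomorphic_maps (subtopology euclideanreal {..<c}) euclideanreal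
      (\<lambda>x. - ln (c - x)) (\<lambda>y. c - exp (- y))"
    unfolding homeomorphic_maps_def
    by (auto simp: continuous_map_in_subtopology intro!: continuous_intros)
  then show ?thesis by (auto simp: homeomorphic_space_def)
qed

text \<open>On an open initial segment \<open>last\<close> is continuous, open and injective, hence
  an embedding; its image is an open ray.\<close>

lemma feather_below_homeomorphic_real:
  assumes "b \<in> feather_carrier"
  shows "subtopology feather (feather_below b) homeomorphic_space (euclidean :: real topology)"
proof -
  let ?X = "subtopology feather (feather_below b)"
  have top: "topspace ?X = feather_below b"
    by (auto simp: topspace_feather feather_below_def)
  have "embedding_map ?X euclideanreal last"
    using assms top openin_feather_below inj_on_last_feather_below
    by (intro injective_open_imp_embedding_map continuous_map_from_subtopology
        continuous_map_last_feather open_map_from_subtopology open_map_last_feather) auto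
  then have "?X homeomorphic_space subtopology euclideanreal {..<last b}"
    using embedding_map_imp_homeomorphic_space top last_image_feather_below[OF assms] by metis
  also have "subtopology euclideanreal {..<last b} homeomorphic_space (euclidean :: real topology)"
    by (rule lessThan_homeomorphic_space_real)
  finally show ?thesis .
qed

lemma feather_in_below:
  assumes "x \<in> feather_carrier"
  obtains b where "b \<in> feather_carrier" "x \<in> feather_below b"
  using assms feather_has_successor[of x] by (auto simp: feather_below_def)

lemma one_manifold_feather: "one_manifold feather"
  unfolding one_manifold_def topspace_feather
  by (metis feather_in_below openin_feather_below feather_below_homeomorphic_real)

section \<open>Connectedness\<close>

lemma connected_space_feather: "connected_space feather"
  unfolding connected_space_subconnected topspace_feather
proof (intro ballI)
  have "connected_space euclideanreal"
    by (metis connectedin_iff_connected connectedin_topspace connected_UNIV topspace_euclidean)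
  then have conn: "connectedin feather (feather_below b)" if "b \<in> feather_carrier" for b
    using feather_below_homeomorphic_real[OF that] openin_subset[OF openin_feather_below[OF that]]
    by (simp add: connectedin_def homeomorphic_connected_space)
  fix x y assume "x \<in> feather_carrier" "y \<in> feather_carrier"
  then obtain b c where b: "b \<in> feather_carrier" "x \<in> feather_below b"
    and c: "c \<in> feather_carrier" "y \<in> feather_below c"
    by (meson feather_in_below)
  \<comment> \<open>A one-entry sequence is below every sequence with larger first entry, so
    \<open>[r]\<close> is a common point of the two connected segments.\<close>
  define r where "r = min (b ! 0) (c ! 0) - 1"
  have "[r] \<in> feather_below b \<inter> feather_below c"
    by (auto simp: feather_below_def feather_carrier_iff feather_less_def r_def)
  then have "connectedin feather (feather_below b \<union> feather_below c)"
    using conn b c by (intro connectedin_Un) auto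
  then show "\<exists>S. connectedin feather S \<and> x \<in> S \<and> y \<in> S"
    using b c by blast
qed

section \<open>Two inseparable points\<close>

lemma feather_not_Hausdorff: "\<not> Hausdorff_space feather"
proof
  assume H: "Hausdorff_space feather"
  have c: "[0] \<in> feather_carrier" "[0, 0] \<in> feather_carrier"
    by (auto simp: feather_carrier_iff)
  \<comment> \<open>The fronts are the empty set and \<open>{0}\<close>, which agree after cutting
    at any negative number.\<close>
  have same: "feather_less a [0] \<longleftrightarrow> feather_less a [0, 0]" if "a \<in> feather_carrier" for a
    using that c by (simp add: feather_less_iff Int_insert_left cong: conj_cong)
  have "\<exists>U V. openin feather U \<and> openin feather V \<and> [0] \<in> U \<and> [0, 0] \<in> V \<and> disjnt U V"
    using H[unfolded Hausdorff_space_def, rule_format, of "[0]" "[0, 0]"] c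
    by (simp add: topspace_feather)
  then obtain U V where UV: "openin feather U" "openin feather V" "[0] \<in> U" "[0, 0] \<in> V"
    "disjnt U V" by blast
  obtain a b where ab: "a \<in> feather_carrier" "b \<in> feather_carrier"
    "[0] \<in> feather_interval a b" "feather_interval a b \<subseteq> U"
    using UV(1,3) unfolding openin_feather_iff by meson
  obtain a' b' where ab': "a' \<in> feather_carrier" "b' \<in> feather_carrier"
    "[0, 0] \<in> feather_interval a' b'" "feather_interval a' b' \<subseteq> V"
    using UV(2,4) unfolding openin_feather_iff by meson
  have less: "feather_less a [0]" "feather_less a' [0]" "feather_less [0] b" "feather_less [0, 0] b'"
    using ab(3) ab'(3) same[OF ab'(1)] by (simp_all add: feather_interval_def)
  have a0: "last a < 0" "last a' < 0"
    using less(1,2) ab(1) ab'(1) c(1) by (simp_all add: feather_less_iff)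
  \<comment> \<open>Halfway between the larger of two negative numbers and 0, so that the cut of
    \<open>[0]\<close> at \<open>r\<close> lies above both \<open>a\<close> and \<open>a'\<close>
    and in both intervals.\<close>
  define r where "r = max (last a) (last a') / 2"
  have r: "r < 0" "last a < r" "last a' < r"
    using a0 by (auto simp: r_def max_def)
  define d where "d = feather_cut [0] r"
  have d: "d \<in> feather_carrier" "feather_less d [0]" "feather_less a d" "feather_less a' d"
    using c(1) ab(1) ab'(1) less(1,2) r by (simp_all add: d_def feather_cut_less less_feather_cut)
  then have "feather_less d [0, 0]" using same by simp
  then have "d \<in> feather_interval a b" "d \<in> feather_interval a' b'"
    using d less feather_less_trans unfolding feather_interval_def by blast+
  then show False using ab(4) ab'(4) UV(5) by (auto simp: disjnt_def)
qed

section \<open>Order automorphisms and homogeneity\<close>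

lemma continuous_map_feather_order_iso:
  assumes h: "\<And>x. x \<in> feather_carrier \<Longrightarrow> h x \<in> feather_carrier"
    and g: "\<And>x. x \<in> feather_carrier \<Longrightarrow> g x \<in> feather_carrier"
    and hg: "\<And>x. x \<in> feather_carrier \<Longrightarrow> h (g x) = x"
    and gh: "\<And>x. x \<in> feather_carrier \<Longrightarrow> g (h x) = x"
    and h_less: "\<And>x y. x \<in> feather_carrier \<Longrightarrow> y \<in> feather_carrier \<Longrightarrow> feather_less x y \<Longrightarrow>
      feather_less (h x) (h y)"
    and g_less: "\<And>x y. x \<in> feather_carrier \<Longrightarrow> y \<in> feather_carrier \<Longrightarrow> feather_less x y \<Longrightarrow>
      feather_less (g x) (g y)"
  shows "continuous_map feather feather h"
  unfolding continuous_map_def topspace_feather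
proof (intro conjI allI impI)
  fix U assume U: "openin feather U"
  show "openin feather {x \<in> feather_carrier. h x \<in> U}"
    unfolding openin_feather_iff
  proof
    fix x assume "x \<in> {x \<in> feather_carrier. h x \<in> U}"
    then have x: "x \<in> feather_carrier" "h x \<in> U" by auto
    then obtain a b where ab: "a \<in> feather_carrier" "b \<in> feather_carrier"
      "h x \<in> feather_interval a b" "feather_interval a b \<subseteq> U"
      using U unfolding openin_feather_iff by meson
    \<comment> \<open>The preimage of the interval from \<open>a\<close> to \<open>b\<close> under
      \<open>h\<close> is the interval from \<open>g a\<close> to \<open>g b\<close>; monotonicity
      of \<open>g\<close> gives one inclusion, that of \<open>h\<close> the other.\<close>
    have "x \<in> feather_interval (g a) (g b)"
      using ab x h gh g_less[of a "h x"] g_less[of "h x" b] by (simp add: feather_interval_def)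
    moreover have "h y \<in> feather_interval a b" if "y \<in> feather_interval (g a) (g b)" for y
      using that ab h g hg h_less[of "g a" y] h_less[of y "g b"] by (simp add: feather_interval_def)
    ultimately show "\<exists>a\<in>feather_carrier. \<exists>b\<in>feather_carrier. x \<in> feather_interval a b \<and>
        feather_interval a b \<subseteq> {x \<in> feather_carrier. h x \<in> U}"
      using ab g by (intro bexI[of _ "g a"] bexI[of _ "g b"]) (auto simp: feather_interval_def)
  qed
qed (use h in auto)

lemma homeomorphic_maps_feather:
  assumes "\<And>x. x \<in> feather_carrier \<Longrightarrow> h x \<in> feather_carrier"
    and "\<And>x. x \<in> feather_carrier \<Longrightarrow> g x \<in> feather_carrier"
    and "\<And>x. x \<in> feather_carrier \<Longrightarrow> h (g x) = x"
    and "\<And>x. x \<in> feather_carrier \<Longrightarrow> g (h x) = x"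
    and "\<And>x y. x \<in> feather_carrier \<Longrightarrow> y \<in> feather_carrier \<Longrightarrow> feather_less x y \<Longrightarrow>
      feather_less (h x) (h y)"
    and "\<And>x y. x \<in> feather_carrier \<Longrightarrow> y \<in> feather_carrier \<Longrightarrow> feather_less x y \<Longrightarrow>
      feather_less (g x) (g y)"
  shows "homeomorphic_maps feather feather h g"
  unfolding homeomorphic_maps_def topspace_feather
  using continuous_map_feather_order_iso[of h g] continuous_map_feather_order_iso[of g h] assms
  by simp

definition feather_shift :: "real \<Rightarrow> real list \<Rightarrow> real list" where
  "feather_shift d = map (\<lambda>x. x + d)"

lemma homeomorphic_map_feather_shift: "homeomorphic_map feather feather (feather_shift d)"
proof -
  have carrier: "feather_shift d x \<in> feather_carrier" if "x \<in> feather_carrier" for d x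
    using that
    by (auto simp: feather_carrier_iff feather_shift_def last_map map_butlast[symmetric]
        sorted_wrt_map)
  have less: "feather_less (feather_shift d x) (feather_shift d y)"
    if "x \<in> feather_carrier" "y \<in> feather_carrier" "feather_less x y" for d x y
  proof -
    \<comment> \<open>The compared positions must lie inside both lists before the entries of the
      mapped lists can be computed.\<close>
    have "length x - 1 < length x" "length x - 1 < length y"
      using that by (auto simp: feather_carrier_iff feather_less_def Let_def
          Suc_pred' simp flip: length_greater_0_conv)
    with that show ?thesis
      by (auto simp: feather_less_def feather_shift_def)
  qed
  have inverse: "feather_shift d (feather_shift (- d) x) = x"
    "feather_shift (- d) (feather_shift d x) = x" for x
    by (simp_all add: feather_shift_def o_def)
  show ?thesis
    unfolding homeomorphic_map_maps
    using homeomorphic_maps_feather carrier inverse less by blast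
qed

definition feather_toggle :: "real set \<Rightarrow> real list \<Rightarrow> real list" where
  "feather_toggle C s = feather_point (sym_diff (set (butlast s)) (C \<inter> {..last s})) (last s)"

text \<open>Symmetric difference commutes with intersecting with \<open>{..r}\<close>, so the order
  is preserved. As \<open>last\<close> is unchanged, a second application toggles the same set back:
  the map is its own inverse.\<close>

lemma homeomorphic_map_feather_toggle:
  assumes "finite C"
  shows "homeomorphic_map feather feather (feather_toggle C)"
proof -
  have last: "last (feather_toggle C x) = last x" for x
    by (simp add: feather_toggle_def)
  have set: "set (butlast (feather_toggle C x)) = sym_diff (set (butlast x)) (C \<inter> {..last x})" for x
    using assms by (simp add: feather_toggle_def)
  have carrier: "feather_toggle C x \<in> feather_carrier" if "x \<in> feather_carrier" for x
    using that assms unfolding feather_toggle_def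
    by (subst feather_point_in_carrier) (auto simp: feather_carrier_iff)
  have inverse: "feather_toggle C (feather_toggle C x) = x" if "x \<in> feather_carrier" for x
    using that carrier by (intro feather_eqI) (auto simp: last set)
  have less: "feather_less (feather_toggle C x) (feather_toggle C y)"
    if "x \<in> feather_carrier" "y \<in> feather_carrier" "feather_less x y" for x y
    using that carrier by (auto simp: feather_less_iff last set)
  show ?thesis
    unfolding homeomorphic_map_maps
    using homeomorphic_maps_feather carrier inverse less by blast
qed

lemma feather_homeomorphic_map_to_origin:
  assumes "x \<in> feather_carrier"
  obtains h where "homeomorphic_map feather feather h" "h x = [0]"
proof
  let ?C = "set (butlast x)"
  show "homeomorphic_map feather feather (feather_shift (- last x) \<circ> feather_toggle ?C)"
    by (rule homeomorphic_map_compose[OF homeomorphic_map_feather_toggle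
          homeomorphic_map_feather_shift]) simp
  \<comment> \<open>The whole front of \<open>x\<close> is toggled off, leaving
    \<open>[last x]\<close>, which the shift takes to \<open>[0]\<close>.\<close>
  have "?C \<inter> {..last x} = ?C" using assms by (auto simp: feather_carrier_iff)
  then show "(feather_shift (- last x) \<circ> feather_toggle ?C) x = [0]"
    by (simp add: feather_toggle_def feather_shift_def feather_point_def)
qed

lemma homogeneous_space_feather: "homogeneous_space feather"
  unfolding homogeneous_space_def topspace_feather
proof (intro ballI)
  fix x y assume x: "x \<in> feather_carrier" and y: "y \<in> feather_carrier"
  obtain h where h: "homeomorphic_map feather feather h" "h x = [0]"
    using feather_homeomorphic_map_to_origin[OF x] .
  obtain k where k: "homeomorphic_map feather feather k" "k y = [0]"
    using feather_homeomorphic_map_to_origin[OF y] .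
  obtain k' where k': "homeomorphic_maps feather feather k k'"
    using k(1) by (auto simp: homeomorphic_map_maps)
  \<comment> \<open>Go from \<open>x\<close> to \<open>[0]\<close> by \<open>h\<close>, then back to
    \<open>y\<close> by the inverse of \<open>k\<close>.\<close>
  have "homeomorphic_map feather feather (k' \<circ> h)"
    using h(1) k' homeomorphic_map_compose homeomorphic_map_maps homeomorphic_maps_sym by blast
  moreover have "(k' \<circ> h) x = y"
    using h(2) k(2) k' y by (auto simp: homeomorphic_maps_def topspace_feather)
  ultimately show "\<exists>h. homeomorphic_map feather feather h \<and> h x = y" by blast
qed

theorem proposition2p1:
  shows "connected_space feather \<and> homogeneous_space feather \<and>
         \<not> Hausdorff_space feather \<and> one_manifold feather"
  using connected_space_feather homogeneous_space_feather feather_not_Hausdorff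
    one_manifold_feather by blast

end
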